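(* Let $f$ be a proper log-concave function on $\mathbb{R}^d$ such that $\hbar$ is its John function. Then \[ e^{-(d+1)}\,\chi_{\frac{1}{d+1}\mathbf{B}^d}\le f^\circ \] pointwise on $\mathbb{R}^d$.
   Context: A function $\mathbb{R}^d\to[0,\infty)$ is proper log-concave if it is upper semi-continuous, log-concave, with finite positive integral. $\mathbf{B}^d$ is the closed Euclidean unit ball and $\chi_S$ the indicator of $S$. The height function is $\hbar(x)=\sqrt{1-|x|^2}$ on $\mathbf{B}^d$ and $0$ otherwise. Positions of $\hbar$ are functions $\beta\,\hbar(Ax+a)$ with $A$ non-singular, $\beta>0$, $a\in\mathbb{R}^d$; "$\hbar$ is the John function of $f$" means $\hbar\le f$ pointwise and $\int g\le\int\hbar$ for every position $g$ of $\hbar$ with $g\le f$. The polar function is $f^\circ(p)=\inf_{\{x:f(x)>0\}}\frac{e^{-\langle p,x\rangle}}{f(x)}$. *)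

theory Defs
  imports "HOL-Analysis.Analysis"
begin

definition upper_semicontinuous :: "('a::topological_space \<Rightarrow> real) \<Rightarrow> bool" where
  "upper_semicontinuous f \<longleftrightarrow> (\<forall>x t. f x < t \<longrightarrow> (\<forall>\<^sub>F y in nhds x. f y < t))"

definition log_concave :: "('a::real_vector \<Rightarrow> real) \<Rightarrow> bool" where
  "log_concave f \<longleftrightarrow> (\<forall>x y l. 0 < l \<and> l < 1 \<longrightarrow>
      f x powr (1 - l) * f y powr l \<le> f ((1 - l) *\<^sub>R x + l *\<^sub>R y))"

definition proper_log_concave :: "('a::euclidean_space \<Rightarrow> real) \<Rightarrow> bool" where
  "proper_log_concave f \<longleftrightarrow> (\<forall>x. 0 \<le> f x) \<and> upper_semicontinuous f \<and> log_concave f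
     \<and> f integrable_on UNIV \<and> integral UNIV f > 0"

definition height_fun :: "'a::euclidean_space \<Rightarrow> real" where
  "height_fun x = (if norm x \<le> 1 then sqrt (1 - (norm x)\<^sup>2) else 0)"

definition is_position_of_height :: "('a::euclidean_space \<Rightarrow> real) \<Rightarrow> bool" where
  "is_position_of_height g \<longleftrightarrow> (\<exists>(A::'a \<Rightarrow> 'a) \<beta> a. linear A \<and> inj A \<and> \<beta> > 0 \<and>
      g = (\<lambda>x. \<beta> * height_fun (A x + a)))"

definition is_John_function_height :: "('a::euclidean_space \<Rightarrow> real) \<Rightarrow> bool" where
  "is_John_function_height f \<longleftrightarrow> (\<forall>x. height_fun x \<le> f x) \<and>
     (\<forall>g::'a \<Rightarrow> real. is_position_of_height g \<and> (\<forall>x. g x \<le> f x) \<longrightarrow>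
        integral UNIV g \<le> integral UNIV (height_fun :: 'a \<Rightarrow> real))"

definition polar_fun :: "('a::euclidean_space \<Rightarrow> real) \<Rightarrow> 'a \<Rightarrow> real" where
  "polar_fun f p = (INF x \<in> {x. f x > 0}. exp (- (p \<bullet> x)) / f x)"

end

theory Submission
  imports Defs
begin

text \<open>
  Write d for the dimension, h for the height function, B for the unit ball of the space with the
  height coordinate added, and n = d + 1. No John decomposition is needed: explicit positions of h
  below f already give the estimate f(x) <= exp (n - |x| / n), which is the claim.

  By log-concavity, the function f(x)^t h((y - t x) / (1 - t)) of y lies below f. Its integral is
  f(x)^t (1 - t)^d times that of h, so maximality with t tending to 0 gives f <= exp d. This
  settles |x| <= n.

  If f(x) >= 1/e, then log-concavity puts the convex hull of the upper half of B and the point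
  (x, 0) below the graph of f. For |x| > n this hull contains half of an ellipsoid of volume larger
  than that of B, as in John's theorem, so f < 1/e outside the ball of radius n. Log-concavity along
  the segment from the origin, where f >= 1, turns this into exponential decay.
\<close>

section \<open>Invariance of Lebesgue measure under orthogonal maps, and reflections\<close>

text \<open>An orthogonal map preserves the volume of balls, and by Vitali's covering theorem an open set is
  a disjoint union of balls up to a null set.\<close>

lemma emeasure_lborel_orthogonal_vimage_open:
  fixes Q :: "'a::euclidean_space \<Rightarrow> 'a"
  assumes Q: "orthogonal_transformation Q" and U: "open U"
  shows "emeasure lborel (Q -` U) = emeasure lborel U"
proof -
  define K where "K = {(x, \<rho>). ball x \<rho> \<subseteq> U}"
  have vit: "\<exists>i. i \<in> K \<and> x \<in> ball (fst i) (snd i) \<and> snd i < d" if x: "x \<in> U" "0 < d" for x d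
  proof -
    obtain e where "e > 0" "ball x e \<subseteq> U" using U x openE by blast
    then have "(x, min e (d/2)) \<in> K" "x \<in> ball x (min e (d/2))" "min e (d/2) < d"
      using x unfolding K_def by auto
    then show ?thesis by (metis fst_conv snd_conv)
  qed
  obtain C where C: "countable C" "C \<subseteq> K"
    and dis: "pairwise (\<lambda>i j. disjnt (ball (fst i) (snd i)) (ball (fst j) (snd j))) C"
    and neg: "negligible (U - (\<Union>i\<in>C. ball (fst i) (snd i)))"
    by (rule Vitali_covering_theorem_balls[of U K fst snd, OF vit])
  define B where "B i = ball (fst i) (snd i)" for i :: "'a \<times> real"
  define N where "N = U - (\<Union>i\<in>C. B i)"
  have BU: "(\<Union>i\<in>C. B i) \<subseteq> U"
    using C(2) unfolding K_def B_def by fastforce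
  have cont: "continuous_on UNIV Q"
    using Q by (simp add: linear_continuous_on linear_linear orthogonal_transformation_linear)
  have Qm [measurable]: "Q \<in> borel \<rightarrow>\<^sub>M borel"
    by (rule borel_measurable_continuous_onI[OF cont])
  have Qv: "Q -` S \<in> sets lborel" if "S \<in> sets borel" for S
    using measurable_sets[OF Qm that] by simp
  have bijQ: "bij Q" using Q by (rule orthogonal_transformation_bij)
  have invQ: "orthogonal_transformation (inv Q)"
    using Q by (rule orthogonal_transformation_inv)
  have vim: "Q -` S = inv Q ` S" for S
    using bijQ by (rule bij_vimage_eq_inv_image)
  have Bb: "B i \<in> sets borel" for i unfolding B_def by simp
  have Nb: "N \<in> sets borel"
    unfolding N_def B_def using U by (intro sets.Diff borel_open open_UN) auto
  \<comment> \<open>\<open>K\<close> also contains pairs with negative radius; their balls are empty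
    and are treated separately.\<close>
  have ballQ: "emeasure lborel (Q -` B i) = emeasure lborel (B i)" for i
  proof (cases "snd i \<ge> 0")
    case True
    have "Q -` B i = ball (inv Q (fst i)) (snd i)"
      unfolding vim B_def by (rule image_orthogonal_transformation_ball[OF invQ])
    then show ?thesis using True by (simp add: B_def emeasure_ball)
  qed (simp add: B_def ball_empty)
  have N0: "emeasure lborel N = 0"
    using neg Nb by (simp add: N_def B_def negligible_iff_null_sets null_sets_def)
  \<comment> \<open>Invariance of the measure is not yet available here, but an isometry is
    Lipschitz, and Lipschitz maps send null sets to null sets.\<close>
  have "negligible (inv Q ` N)"
  proof (rule negligible_locally_Lipschitz_image)
    show "negligible N" using neg by (simp add: N_def B_def)
    fix x
    have "norm (inv Q y - inv Q x) \<le> 1 * norm (y - x)" for y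
      using invQ by (simp add: orthogonal_transformation flip: linear_diff)
    then show "\<exists>T B. open T \<and> x \<in> T \<and> (\<forall>y\<in>N \<inter> T. norm (inv Q y - inv Q x) \<le> B * norm (y - x))"
      by (intro exI[of _ UNIV] exI[of _ 1]) auto
  qed simp
  then have QN0: "emeasure lborel (Q -` N) = 0"
    using Qv[OF Nb] by (simp add: vim negligible_iff_null_sets null_sets_def)
  \<comment> \<open>Stated for a general \<open>g\<close> so that it applies both to
    \<open>Q\<close> and to the identity; by \<open>ballQ\<close> the two resulting sums agree term
    by term.\<close>
  have split: "emeasure lborel (g -` U) = (\<integral>\<^sup>+i. emeasure lborel (g -` B i) \<partial>count_space C)"
    if g: "\<And>S. S \<in> sets borel \<Longrightarrow> g -` S \<in> sets lborel"
      and g0: "emeasure lborel (g -` N) = 0" for g :: "'a \<Rightarrow> 'a"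
  proof -
    have "g -` U = (\<Union>i\<in>C. g -` B i) \<union> g -` N"
      using BU unfolding N_def by auto
    moreover have "emeasure lborel ((\<Union>i\<in>C. g -` B i) \<union> g -` N) = emeasure lborel (\<Union>i\<in>C. g -` B i)"
      using g g0 Nb Bb C(1) by (intro emeasure_Un_null_set sets.countable_UN') (auto simp: null_sets_def)
    moreover have "emeasure lborel (\<Union>i\<in>C. g -` B i) = (\<integral>\<^sup>+i. emeasure lborel (g -` B i) \<partial>count_space C)"
    proof (rule emeasure_UN_countable)
      show "disjoint_family_on (\<lambda>i. g -` B i) C"
        using dis unfolding disjoint_family_on_def pairwise_def disjnt_def B_def[symmetric]
        by (metis vimage_Int vimage_empty)
    qed (use g Bb C(1) in auto)
    ultimately show ?thesis by simp
  qed
  show ?thesis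
    using split[of Q, OF Qv QN0] split[of id] N0 ballQ by simp
qed

text \<open>Lebesgue measure is determined by its values on boxes. The preimage of a box under
  \<open>Q\<close> is in general no box, but it is the preimage of an open set, which the preceding
  lemma handles.\<close>

lemma lborel_distr_orthogonal:
  fixes Q :: "'a::euclidean_space \<Rightarrow> 'a"
  assumes Q: "orthogonal_transformation Q"
  shows "distr lborel borel Q = lborel"
proof (rule lborel_eqI[symmetric])
  have [measurable]: "Q \<in> borel \<rightarrow>\<^sub>M borel"
    using Q by (intro borel_measurable_continuous_onI)
      (simp add: linear_continuous_on linear_linear orthogonal_transformation_linear)
  fix l u :: 'a assume le: "\<And>b. b \<in> Basis \<Longrightarrow> l \<bullet> b \<le> u \<bullet> b"
  have "emeasure (distr lborel borel Q) (box l u) = emeasure lborel (Q -` box l u)"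
    by (subst emeasure_distr) auto
  also have "\<dots> = emeasure lborel (box l u)"
    using Q by (intro emeasure_lborel_orthogonal_vimage_open) auto
  finally show "emeasure (distr lborel borel Q) (box l u) = ennreal (\<Prod>b\<in>Basis. (u - l) \<bullet> b)"
    using le by (simp add: emeasure_lborel_box)
qed simp

text \<open>The reflection in the hyperplane orthogonal to \<open>e - b\<close> swaps the two unit
  vectors. It later carries an arbitrary axis to a basis vector, so that a stretch along that axis
  becomes a diagonal map.\<close>

lemma orthogonal_transformation_exists_involution:
  fixes e b :: "'a::euclidean_space"
  assumes "norm e = 1" "norm b = 1"
  obtains Q where "orthogonal_transformation Q" "Q e = b" "Q b = e" "\<And>x. Q (Q x) = x"
proof (cases "e = b")
  case True
  show ?thesis by (rule that[of "\<lambda>x. x"]) (simp_all add: True)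
next
  case False
  define w where "w = e - b"
  define Q where "Q x = x - (2 * (x \<bullet> w) / (w \<bullet> w)) *\<^sub>R w" for x
  have w: "w \<bullet> w \<noteq> 0" using False by (simp add: w_def)
  have lin: "linear Q"
    by (rule linearI) (auto simp: Q_def algebra_simps inner_add_left add_divide_distrib)
  have nrm: "Q x \<bullet> Q y = x \<bullet> y" for x y
    using w by (simp add: Q_def inner_diff_left inner_diff_right field_simps inner_commute)
  have eb: "e \<bullet> e = 1" "b \<bullet> b = 1" using assms by (simp_all add: dot_square_norm)
  have "w \<bullet> w = 2 * (e \<bullet> w)" "w \<bullet> w = - 2 * (b \<bullet> w)"
    using eb by (simp_all add: w_def inner_diff_left inner_diff_right inner_commute)
  then have "2 * (e \<bullet> w) / (w \<bullet> w) = 1" "2 * (b \<bullet> w) / (w \<bullet> w) = -1"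
    using w by (simp_all add: field_simps)
  then have "Q e = b" "Q b = e" by (auto simp: Q_def w_def)
  moreover have "Q (Q x) = x" for x
    using w by (simp add: Q_def inner_diff_left algebra_simps diff_divide_distrib flip: scaleR_left.add)
  ultimately show ?thesis
    using that[of Q] lin nrm by (auto simp: orthogonal_transformation_def)
qed

section \<open>Range, continuity and integral of the height function\<close>

lemma height_fun_nonneg: "0 \<le> height_fun x"
  by (simp add: height_fun_def power_le_one)

lemma height_fun_le_1: "height_fun x \<le> 1"
  by (simp add: height_fun_def)

lemma continuous_on_height_fun: "continuous_on S (height_fun :: 'a::euclidean_space \<Rightarrow> real)"
proof -
  have "height_fun = (\<lambda>x::'a. sqrt (max 0 (1 - (norm x)\<^sup>2)))"
    by (auto simp: fun_eq_iff height_fun_def max_def abs_square_le_1 power_le_one_iff)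
  moreover have "continuous_on S (\<lambda>x::'a. sqrt (max 0 (1 - (norm x)\<^sup>2)))"
    by (intro continuous_intros)
  ultimately show ?thesis by metis
qed

lemma borel_measurable_height_fun [measurable]: "height_fun \<in> borel_measurable borel"
  by (rule borel_measurable_continuous_onI[OF continuous_on_height_fun])

lemma integrable_height_fun: "integrable lborel (height_fun :: 'a::euclidean_space \<Rightarrow> real)"
proof -
  have "integrable lborel (\<lambda>x::'a. indicator (cball 0 1) x *\<^sub>R height_fun x)"
    by (rule borel_integrable_compact[OF compact_cball continuous_on_height_fun])
  moreover have "(\<lambda>x::'a. indicator (cball 0 1) x *\<^sub>R height_fun x) = height_fun"
    by (auto simp: fun_eq_iff height_fun_def indicator_def)
  ultimately show ?thesis by simp
qed

lemma integral_height_fun_pos: "0 < (\<integral>x. height_fun x \<partial>(lborel :: 'a::euclidean_space measure))"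
proof -
  have "0 < 1/2 * measure lborel (ball (0::'a) (1/2))"
    by (simp add: content_ball_pos)
  also have "\<dots> = (\<integral>x. 1/2 * indicator (ball 0 (1/2)) x \<partial>(lborel :: 'a measure))"
    by simp
  also have "\<dots> \<le> (\<integral>x. height_fun x \<partial>(lborel :: 'a measure))"
  proof (rule Bochner_Integration.integral_mono)
    show "integrable lborel (\<lambda>x::'a. 1/2 * indicator (ball 0 (1/2)) x :: real)"
      by (intro integrable_mult_right integrable_real_indicator)
        (use emeasure_lborel_ball_finite[of 0 "1/2"] in auto)
    fix x :: 'a
    show "1/2 * indicator (ball 0 (1/2)) x \<le> height_fun x"
    proof (cases "norm x < 1/2")
      case True
      then have "(norm x)\<^sup>2 \<le> (1/2)\<^sup>2" by (intro power_mono) auto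
      then have "1/2 \<le> sqrt (1 - (norm x)\<^sup>2)"
        by (intro real_le_rsqrt) (simp add: power2_eq_square)
      then show ?thesis using True by (simp add: height_fun_def)
    qed (simp add: height_fun_nonneg)
  qed (rule integrable_height_fun)
  finally show ?thesis .
qed

section \<open>Maximality of the integral, tested on positions stretched along one axis\<close>

text \<open>The affine map of \<open>y\<close> inside \<open>f\<close> has semi-axis
  \<open>a\<close> along \<open>e\<close> and \<open>b\<close> in the orthogonal directions, hence
  determinant \<open>a * b ^ (DIM('a) - 1)\<close>. Composing the height function with its inverse
  and scaling by \<open>\<beta>\<close> gives a position below \<open>f\<close>, whose integral is
  \<open>\<beta>\<close> times this determinant times that of the height function. Formulating the
  hypothesis through \<open>y\<close> spares the applications the inverse map.\<close>

lemma John_function_height_volume_bound: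
  fixes f :: "'a::euclidean_space \<Rightarrow> real"
  assumes John: "is_John_function_height f" and e: "norm e = 1"
    and pos: "0 < a" "0 < b" "0 < \<beta>"
    and le: "\<And>y. \<beta> * height_fun y \<le> f (m + b *\<^sub>R y + ((a - b) * (y \<bullet> e)) *\<^sub>R e)"
  shows "\<beta> * a * b ^ (DIM('a) - 1) \<le> 1"
proof -
  obtain i :: 'a where i: "i \<in> Basis" using nonempty_Basis by blast
  then obtain Q where Q: "orthogonal_transformation Q" and Qe: "Q e = i" "Q i = e"
    and QQ: "\<And>x. Q (Q x) = x"
    using orthogonal_transformation_exists_involution[OF e, of i] by auto
  have linQ: "linear Q" and normQ: "\<And>x. norm (Q x) = norm x"
    using Q by (simp_all add: orthogonal_transformation)
  \<comment> \<open>\<open>D\<close> is the linear part of the inverse map, written in the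
    coordinates in which \<open>Q\<close> has moved the axis \<open>e\<close> to the basis vector
    \<open>i\<close>.\<close>
  define c where "c j = (if j = i then 1/a else 1/b)" for j
  define D where "D z = (\<Sum>j\<in>Basis. (c j * (z \<bullet> j)) *\<^sub>R j)" for z
  have D: "D z = (1/b) *\<^sub>R z + ((1/a - 1/b) * (z \<bullet> i)) *\<^sub>R i" for z
  proof -
    have "D z = (\<Sum>j\<in>Basis. (1/b) *\<^sub>R ((z \<bullet> j) *\<^sub>R j) + (if j = i then ((1/a - 1/b) * (z \<bullet> i)) *\<^sub>R i else 0))"
      unfolding D_def c_def by (intro sum.cong) (auto simp: algebra_simps)
    also have "\<dots> = (1/b) *\<^sub>R z + ((1/a - 1/b) * (z \<bullet> i)) *\<^sub>R i"
      unfolding sum.distrib scaleR_sum_right[symmetric] euclidean_representation using i by simp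
    finally show ?thesis .
  qed
  have linD: "linear D"
    unfolding D by (rule linearI) (auto simp: algebra_simps inner_add_left)
  define t where "t = - D (Q m)"
  define g where "g x = \<beta> * height_fun (D (Q x) + t)" for x
  \<comment> \<open>The true inverse is \<open>Q (D (Q (x - m)))\<close>. The outer \<open>Q\<close>
    preserves norms, so the height function does not see it and \<open>g\<close> omits it.\<close>
  have inverse: "m + b *\<^sub>R y + ((a - b) * (y \<bullet> e)) *\<^sub>R e = x" "height_fun y = height_fun (D (Q x) + t)"
    if y: "y = Q (D (Q (x - m)))" for x y
  proof -
    have Dx: "D (Q (x - m)) = D (Q x) + t"
      using linD linQ by (simp add: t_def linear_diff)
    then show "height_fun y = height_fun (D (Q x) + t)"
      by (simp add: y height_fun_def normQ)
    define s where "s = Q (x - m) \<bullet> i"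
    have yx: "y = (1/b) *\<^sub>R (x - m) + ((1/a - 1/b) * s) *\<^sub>R e"
      using linQ by (simp add: y D s_def linear_add linear_scale QQ Qe)
    have ye: "y \<bullet> e = s / a"
    proof -
      have "y \<bullet> e = Q y \<bullet> Q e" using Q by (simp add: orthogonal_transformation_def)
      also have "\<dots> = D (Q (x - m)) \<bullet> i" by (simp add: y QQ Qe)
      also have "\<dots> = s / a"
        using i by (simp add: D s_def inner_add_left left_diff_distrib)
      finally show ?thesis .
    qed
    have "b *\<^sub>R y = (x - m) + (b * ((1/a - 1/b) * s)) *\<^sub>R e"
      using pos by (simp add: yx scaleR_add_right)
    also have "b * ((1/a - 1/b) * s) = - ((a - b) * (s / a))"
      using pos by (simp add: field_simps)
    finally show "m + b *\<^sub>R y + ((a - b) * (y \<bullet> e)) *\<^sub>R e = x"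
      by (simp only: ye scaleR_minus_left) simp
  qed
  have gf: "g x \<le> f x" for x
    using le[of "Q (D (Q (x - m)))"] inverse[OF refl, of x] by (simp add: g_def)
  have c0: "c j \<noteq> 0" for j using pos by (simp add: c_def)
  have injD: "inj D"
  proof (rule injI)
    fix x y assume "D x = D y"
    have "D z \<bullet> j = c j * (z \<bullet> j)" if "j \<in> Basis" for z j
      using that by (simp add: D_def)
    then have "x \<bullet> j = y \<bullet> j" if "j \<in> Basis" for j
      using that \<open>D x = D y\<close> c0[of j] by (metis mult_cancel_left)
    then show "x = y" by (rule euclidean_eqI)
  qed
  have "is_position_of_height g"
    unfolding is_position_of_height_def g_def
  proof (intro exI conjI)
    show "linear (\<lambda>x. D (Q x))" using linear_compose[OF linQ linD] by (simp add: o_def)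
    show "inj (\<lambda>x. D (Q x))"
      using inj_compose[OF injD orthogonal_transformation_inj[OF Q]] by (simp add: o_def)
  qed (use pos in auto)
  then have vol: "integral UNIV g \<le> integral UNIV (height_fun :: 'a \<Rightarrow> real)"
    using John gf by (simp add: is_John_function_height_def)
  define P where "P = (\<Prod>j\<in>(Basis::'a set). \<bar>c j\<bar>)"
  have P: "P = 1 / (a * b ^ (DIM('a) - 1))"
  proof -
    have "P = \<bar>c i\<bar> * (\<Prod>j\<in>Basis - {i}. \<bar>c j\<bar>)"
      unfolding P_def using i by (simp add: prod.remove)
    also have "(\<Prod>j\<in>Basis - {i}. \<bar>c j\<bar>) = (\<Prod>j\<in>Basis - {i}. 1 / b)"
      using pos by (intro prod.cong) (auto simp: c_def)
    finally show ?thesis using pos i by (simp add: c_def power_one_over)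
  qed
  have P0: "P > 0" using P pos by simp
  have Dm [measurable]: "D \<in> borel_measurable borel"
    by (intro borel_measurable_continuous_onI linear_continuous_on) (simp add: linD linear_linear)
  have Qm [measurable]: "Q \<in> borel_measurable borel"
    by (intro borel_measurable_continuous_onI linear_continuous_on) (simp add: linQ linear_linear)
  \<comment> \<open>Change of variables for the diagonal map: \<open>P\<close> is the absolute value
    of its determinant.\<close>
  have lb: "lborel = density (distr lborel borel (\<lambda>x. t + D x)) (\<lambda>_. ennreal P)"
    using lborel_affine_euclidean[of c t, OF c0] by (simp add: D_def P_def)
  have ih: "integrable (density (distr lborel borel (\<lambda>x. t + D x)) (\<lambda>_. ennreal P)) (height_fun :: 'a \<Rightarrow> real)"
    using integrable_height_fun by (simp flip: lb)
  then have iD: "integrable lborel (\<lambda>x. height_fun (t + D x))"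
    using P0 by (simp add: integrable_density integrable_distr_eq)
  have "(\<integral>x. height_fun x \<partial>(lborel :: 'a measure)) =
      (\<integral>x. height_fun x \<partial>(density (distr lborel borel (\<lambda>x. t + D x)) (\<lambda>_. ennreal P)))"
    by (simp flip: lb)
  also have "\<dots> = P * (\<integral>x. height_fun (t + D x) \<partial>lborel)"
    using P0 by (simp add: integral_density integral_distr)
  finally have ID: "(\<integral>x. height_fun x \<partial>(lborel :: 'a measure)) = P * (\<integral>x. height_fun (t + D x) \<partial>lborel)" .
  have "integrable (distr lborel borel Q) (\<lambda>x. height_fun (t + D x))"
    using iD by (simp add: lborel_distr_orthogonal[OF Q])
  then have ig: "integrable lborel g"
    by (simp add: integrable_distr_eq g_def[abs_def] add.commute)
  have "(\<integral>x. height_fun (t + D x) \<partial>lborel) = (\<integral>x. height_fun (t + D x) \<partial>(distr lborel borel Q))"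
    by (simp add: lborel_distr_orthogonal[OF Q])
  also have "\<dots> = (\<integral>x. height_fun (t + D (Q x)) \<partial>lborel)"
    by (simp add: integral_distr)
  finally have "(\<integral>x. g x \<partial>lborel) = \<beta> * (\<integral>x. height_fun (t + D x) \<partial>lborel)"
    by (simp add: g_def[abs_def] add.commute)
  \<comment> \<open>Both integrals are now multiples of the same positive integral, which cancels
    and leaves \<open>\<beta> \<le> P\<close>.\<close>
  then have "\<beta> * (\<integral>x. height_fun (t + D x) \<partial>lborel) \<le> P * (\<integral>x. height_fun (t + D x) \<partial>lborel)"
    using vol ID by (simp add: integral_lborel ig integrable_height_fun)
  moreover have "(\<integral>x. height_fun (t + D x) \<partial>lborel) > 0"
    using ID P0 integral_height_fun_pos[where 'a='a] by (simp add: zero_less_mult_iff)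
  ultimately have "\<beta> \<le> P" by simp
  then show ?thesis using pos by (simp add: P field_simps)
qed

section \<open>Log-concavity and the global bound by exp d\<close>

lemma log_concave_powr_le:
  assumes "log_concave f" "0 < l" "l < 1" "0 \<le> s" "s \<le> f x" "0 \<le> t" "t \<le> f y"
  shows "s powr (1 - l) * t powr l \<le> f ((1 - l) *\<^sub>R x + l *\<^sub>R y)"
proof -
  have "s powr (1 - l) * t powr l \<le> f x powr (1 - l) * f y powr l"
    using assms by (intro mult_mono powr_mono2) auto
  also have "\<dots> \<le> f ((1 - l) *\<^sub>R x + l *\<^sub>R y)"
    using assms by (simp add: log_concave_def)
  finally show ?thesis .
qed

text \<open>This replaces the power of the height function produced by log-concavity by the height
  function itself, so that genuine positions arise.\<close>

lemma le_powr_of_le_1: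
  fixes h :: real
  assumes "0 \<le> h" "h \<le> 1" "l \<le> 1"
  shows "h \<le> h powr l"
proof (cases "h = 0")
  case False
  then have "h powr 1 \<le> h powr l" using assms by (intro powr_mono') auto
  then show ?thesis using assms by simp
qed simp

lemma John_function_height_le_exp_DIM:
  fixes f :: "'a::euclidean_space \<Rightarrow> real"
  assumes lc: "log_concave f" and John: "is_John_function_height f"
  shows "f x \<le> exp (real DIM('a))"
proof (cases "f x > 0")
  case True
  define L where "L = ln (f x)"
  have hf: "height_fun y \<le> f y" for y using John by (simp add: is_John_function_height_def)
  obtain e :: 'a where e: "norm e = 1" using vector_choose_size[of 1] by auto
  \<comment> \<open>The volume bound is used with both semi-axes equal to \<open>1 - t\<close>, so
    the choice of \<open>e\<close> is immaterial. Its logarithm is divided by \<open>t\<close>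
    before \<open>t\<close> tends to 0.\<close>
  have bound: "(1 - t) * L \<le> real DIM('a)" if t: "0 < t" "t < 1" for t
  proof -
    have "f x powr t * (1 - t) * (1 - t) ^ (DIM('a) - 1) \<le> 1"
    proof (rule John_function_height_volume_bound[OF John e, where m = "t *\<^sub>R x"])
      fix y :: 'a
      have "f x powr t * height_fun y \<le> height_fun y powr (1 - t) * f x powr t"
        using t le_powr_of_le_1[OF height_fun_nonneg height_fun_le_1, of "1 - t" y]
        by (subst mult.commute) (intro mult_right_mono, auto)
      also have "\<dots> \<le> f ((1 - t) *\<^sub>R y + t *\<^sub>R x)"
        using t True by (intro log_concave_powr_le[OF lc]) (auto simp: hf height_fun_nonneg)
      finally show "f x powr t * height_fun y
          \<le> f (t *\<^sub>R x + (1 - t) *\<^sub>R y + ((1 - t - (1 - t)) * (y \<bullet> e)) *\<^sub>R e)"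
        by (simp add: add.commute)
    qed (use t True in auto)
    also have "f x powr t * (1 - t) * (1 - t) ^ (DIM('a) - 1) = f x powr t * (1 - t) ^ DIM('a)"
      by (simp add: power_eq_if)
    finally have "ln (f x powr t * (1 - t) ^ DIM('a)) \<le> 0"
      using True t by simp
    then have "t * L + DIM('a) * ln (1 - t) \<le> 0"
      using True t by (simp add: ln_mult ln_realpow ln_powr L_def)
    moreover have "- ln (1 - t) \<le> t / (1 - t)"
    proof -
      have "ln (1 / (1 - t)) \<le> 1 / (1 - t) - 1"
        using t by (intro ln_le_minus_one) auto
      also have "1 / (1 - t) - 1 = t / (1 - t)" using t by (simp add: field_simps)
      finally show ?thesis using t by (simp add: ln_div)
    qed
    then have "DIM('a) * (- ln (1 - t)) \<le> DIM('a) * (t / (1 - t))"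
      by (intro mult_left_mono) auto
    ultimately have "t * L \<le> DIM('a) * (t / (1 - t))" by simp
    then have "t * ((1 - t) * L) \<le> t * DIM('a)" using t by (simp add: field_simps)
    then show ?thesis using t by simp
  qed
  have "((\<lambda>t. (1 - t) * L) \<longlongrightarrow> (1 - 0) * L) (at_right 0)"
    by (intro tendsto_intros)
  moreover have "\<forall>\<^sub>F t in at_right 0. (1 - t) * L \<le> real DIM('a)"
    using eventually_at_right_real[OF zero_less_one] by eventually_elim (use bound in auto)
  ultimately have "L \<le> real DIM('a)"
    using tendsto_upperbound[of "\<lambda>t. (1 - t) * L" _ "at_right 0"] by (simp add: trivial_limit_at_right_real)
  then have "exp L \<le> exp (real DIM('a))" by simp
  then show ?thesis using True by (simp add: L_def)
qed (simp add: order_trans[OF _ less_imp_le[OF exp_gt_zero]])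

section \<open>Values below 1/e outside the ball of radius d + 1\<close>

lemma John_function_height_lt_exp_minus_1:
  fixes f :: "'a::euclidean_space \<Rightarrow> real"
  assumes lc: "log_concave f" and John: "is_John_function_height f"
    and x: "real (DIM('a) + 1) < norm x"
  shows "f x < exp (- 1)"
proof (rule ccontr)
  assume "\<not> f x < exp (- 1)"
  then have fx: "exp (- 1) \<le> f x" by simp
  have hf: "height_fun y \<le> f y" for y using John by (simp add: is_John_function_height_def)
  define r where "r = norm x"
  define e where "e = x /\<^sub>R r"
  \<comment> \<open>\<open>\<theta> < 1\<close> is exactly the assumption on \<open>norm x\<close>.
    The ellipsoid has centre \<open>\<eta> *\<^sub>R e\<close>, semi-axis \<open>1 + \<eta>\<close>
    along \<open>e\<close> and \<open>b\<close> in the d other directions, the height included. To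
    first order its squared volume ratio gains \<open>2 * \<eta>\<close> and loses
    \<open>d * z = 2 * \<eta> * \<theta>\<close>; the factor 1/4 in \<open>\<eta>\<close> keeps the
    second-order loss below the net gain.\<close>
  define \<theta> where "\<theta> = real DIM('a) / (r - 1)"
  define \<eta> where "\<eta> = (1 - \<theta>) / 4"
  define z where "z = 2 * \<eta> / (r - 1)"
  define b where "b = sqrt (1 - z)"
  have r: "r > real DIM('a) + 1" using x by (simp add: r_def)
  have D1: "real DIM('a) \<ge> 1" using DIM_positive[where 'a='a] by linarith
  have "r \<noteq> 0" "x \<noteq> 0" using r D1 by (auto simp: r_def)
  then have e: "norm e = 1" "x = r *\<^sub>R e" by (simp_all add: e_def r_def)
  have \<theta>: "0 < \<theta>" "\<theta> < 1" using r D1 by (auto simp: \<theta>_def field_simps)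
  have \<eta>: "0 < \<eta>" "\<eta> < 1/4" using \<theta> by (auto simp: \<eta>_def)
  have "2 * \<eta> < r - 1" using \<eta> r D1 by linarith
  then have z: "0 < z" "z < 1" using \<eta> by (auto simp: z_def)
  have b: "0 < b" "b\<^sup>2 = 1 - z" using z by (auto simp: b_def)
  have ee: "e \<bullet> e = 1" using e by (simp add: dot_square_norm)
  \<comment> \<open>In the plane of e and the height axis this is the ellipse touching the unit circle at -e and the
    two tangents to the circle from x; tangency determines b.\<close>
  have "b * (1 + \<eta>) * b ^ (DIM('a) - 1) \<le> 1"
  proof (rule John_function_height_volume_bound[OF John e(1), where m = "\<eta> *\<^sub>R e"])
    fix y :: 'a
    define T where "T = \<eta> *\<^sub>R e + b *\<^sub>R y + ((1 + \<eta> - b) * (y \<bullet> e)) *\<^sub>R e"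
    have "b * height_fun y \<le> f T"
    proof (cases "norm y < 1")
      case False
      then have "height_fun y = 0" by (auto simp: height_fun_def)
      then show ?thesis using order_trans[OF height_fun_nonneg hf] by simp
    next
      case True
      define p where "p = y \<bullet> e"
      have "\<bar>p\<bar> < 1" using Cauchy_Schwarz_ineq2[of y e] e(1) True by (simp add: p_def)
      \<comment> \<open>\<open>l\<close> is the weight of \<open>x\<close> when the ellipsoid point
        of height \<open>b * height_fun y\<close> above \<open>T\<close> is written as a convex
        combination of \<open>(x, 0)\<close> and a point of the unit sphere above \<open>v\<close>.
        It vanishes at the touching point \<open>-e\<close>, where \<open>p = -1\<close>.\<close>
      define l where "l = \<eta> * (1 + p) / (r - 1)"
      have l: "0 < l" "l < 1"
      proof -
        show "0 < l" using \<open>\<bar>p\<bar> < 1\<close> \<eta> r D1 by (auto simp: l_def)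
        have "l \<le> \<eta> * 2 / (r - 1)"
          unfolding l_def using \<open>\<bar>p\<bar> < 1\<close> \<eta> r D1 by (intro divide_right_mono mult_left_mono) auto
        then show "l < 1" using z by (simp add: z_def mult.commute)
      qed
      define c where "c = \<eta> + (1 + \<eta> - b) * p - l * r"
      define v where "v = (b *\<^sub>R y + c *\<^sub>R e) /\<^sub>R (1 - l)"
      have v: "(1 - l) *\<^sub>R v = b *\<^sub>R y + c *\<^sub>R e" using l by (simp add: v_def)
      then have T: "T = (1 - l) *\<^sub>R v + l *\<^sub>R x"
        by (simp add: T_def c_def e(2) p_def algebra_simps)
      \<comment> \<open>After division by \<open>(1 - l)\<^sup>2\<close> this says that the point
        above \<open>v\<close> of height \<open>b * height_fun y / (1 - l)\<close> lies on the unit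
        sphere.\<close>
      have key: "(norm (b *\<^sub>R y + c *\<^sub>R e))\<^sup>2 + b\<^sup>2 * (1 - (norm y)\<^sup>2) = (1 - l)\<^sup>2"
      proof -
        have "(norm (b *\<^sub>R y + c *\<^sub>R e))\<^sup>2 = b\<^sup>2 * (norm y)\<^sup>2 + 2 * b * c * p + c\<^sup>2"
          unfolding power2_norm_eq_inner using ee
          by (simp add: inner_add_left inner_add_right p_def power2_eq_square inner_commute algebra_simps)
        then have "(norm (b *\<^sub>R y + c *\<^sub>R e))\<^sup>2 + b\<^sup>2 * (1 - (norm y)\<^sup>2)
            = b\<^sup>2 * (1 - p\<^sup>2) + (b * p + c)\<^sup>2"
          by (simp add: power2_eq_square algebra_simps)
        also have "b * p + c = \<eta> + (1 + \<eta>) * p - l * r"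
          by (simp add: c_def algebra_simps)
        also have "b\<^sup>2 * (1 - p\<^sup>2) + (\<eta> + (1 + \<eta>) * p - l * r)\<^sup>2 = (1 - l)\<^sup>2"
        proof -
          \<comment> \<open>In terms of \<open>k\<close> the identity is polynomial: the second
            square is that of \<open>p - l\<close>, and \<open>b\<^sup>2 = 1 - 2 * k\<close> is what
            makes the sum a perfect square.\<close>
          define k where "k = \<eta> / (r - 1)"
          have k: "\<eta> = k * (r - 1)" using r D1 by (simp add: k_def)
          have lb: "l = k * (1 + p)" "b\<^sup>2 = 1 - 2 * k" by (simp_all add: l_def k_def b z_def)
          show ?thesis unfolding k lb by (simp add: power2_eq_square algebra_simps)
        qed
        finally show ?thesis .
      qed
      have hv: "(1 - l) * height_fun v = b * height_fun y"
      proof -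
        have nv: "(1 - l)\<^sup>2 * (1 - (norm v)\<^sup>2) = b\<^sup>2 * (1 - (norm y)\<^sup>2)"
        proof -
          have "(norm (b *\<^sub>R y + c *\<^sub>R e))\<^sup>2 = (1 - l)\<^sup>2 * (norm v)\<^sup>2"
            by (metis v norm_scaleR power2_abs power_mult_distrib)
          then show ?thesis using key by (simp add: right_diff_distrib)
        qed
        have y2: "(norm y)\<^sup>2 < 1" using True by (simp add: abs_square_less_1)
        then have "0 < (1 - l)\<^sup>2 * (1 - (norm v)\<^sup>2)" using b(1) by (simp add: nv)
        then have "(norm v)\<^sup>2 < 1" using l by (simp add: zero_less_mult_iff)
        then have "norm v \<le> 1" by (simp add: abs_square_less_1)
        then have "(1 - l) * height_fun v = sqrt ((1 - l)\<^sup>2 * (1 - (norm v)\<^sup>2))"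
          using l by (simp add: height_fun_def real_sqrt_mult)
        also have "\<dots> = b * height_fun y"
          using b(1) True by (simp add: nv height_fun_def real_sqrt_mult)
        finally show ?thesis .
      qed
      \<comment> \<open>The threshold 1/e enters here: the linear weight \<open>1 - l\<close> is at
        most \<open>exp (- l)\<close>, the contribution of the value \<open>exp (- 1)\<close> at
        \<open>x\<close> with weight \<open>l\<close>.\<close>
      have "(1 - l) * height_fun v \<le> exp (- l) * height_fun v powr (1 - l)"
        using l exp_ge_add_one_self[of "- l"]
        by (intro mult_mono le_powr_of_le_1 height_fun_nonneg height_fun_le_1) auto
      also have "\<dots> = height_fun v powr (1 - l) * exp (- 1) powr l"
        by (simp add: powr_def)
      also have "\<dots> \<le> f T"
        unfolding T using l fx by (intro log_concave_powr_le[OF lc]) (auto simp: hf height_fun_nonneg)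
      finally show ?thesis by (simp add: hv)
    qed
    then show "b * height_fun y \<le> f (\<eta> *\<^sub>R e + b *\<^sub>R y + ((1 + \<eta> - b) * (y \<bullet> e)) *\<^sub>R e)"
      by (simp add: T_def)
  qed (use \<eta> b in auto)
  then have "(1 + \<eta>) * b ^ DIM('a) \<le> 1"
    by (simp add: power_eq_if mult.commute mult.left_commute)
  \<comment> \<open>Squaring removes the root in \<open>b\<close>, after which Bernoulli's
    inequality applies to \<open>1 - z\<close>.\<close>
  then have "((1 + \<eta>) * b ^ DIM('a))\<^sup>2 \<le> 1"
    using \<eta> b by (intro power_le_one) auto
  then have le1: "(1 + \<eta>)\<^sup>2 * (1 - z) ^ DIM('a) \<le> 1"
    by (simp add: power_mult_distrib power_even_eq flip: b(2) power_mult)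
  have "1 - 2 * \<eta> * \<theta> \<le> (1 - z) ^ DIM('a)"
    using Bernoulli_inequality[of "- z" "DIM('a)"] z by (simp add: z_def \<theta>_def field_simps)
  then have "(1 + \<eta>)\<^sup>2 * (1 - 2 * \<eta> * \<theta>) \<le> (1 + \<eta>)\<^sup>2 * (1 - z) ^ DIM('a)"
    by (intro mult_left_mono) auto
  moreover have "(1 + 2 * \<eta>) * (1 - 2 * \<eta> * \<theta>) \<le> (1 + \<eta>)\<^sup>2 * (1 - 2 * \<eta> * \<theta>)"
  proof (rule mult_right_mono)
    have "\<eta> * \<theta> \<le> 1/4 * 1" using \<eta> \<theta> by (intro mult_mono) auto
    then show "0 \<le> 1 - 2 * \<eta> * \<theta>" by simp
  qed (simp add: power2_eq_square algebra_simps)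
  moreover have "(1 + 2 * \<eta>) * (1 - 2 * \<eta> * \<theta>) > 1"
  proof -
    have \<theta>\<eta>: "\<theta> = 1 - 4 * \<eta>" by (simp add: \<eta>_def field_simps)
    have "(1 + 2 * \<eta>) * (1 - 2 * \<eta> * \<theta>) - 1 = 4 * \<eta>\<^sup>2 * (1 + 4 * \<eta>)"
      unfolding \<theta>\<eta> by (simp add: power2_eq_square algebra_simps)
    then show ?thesis using \<eta> by (smt (verit) mult_pos_pos zero_less_power)
  qed
  ultimately show False using le1 by linarith
qed

section \<open>Exponential decay and the estimate of the polar function\<close>

lemma John_function_height_le_exp_decay:
  fixes f :: "'a::euclidean_space \<Rightarrow> real"
  assumes lc: "log_concave f" and John: "is_John_function_height f"
  defines "n \<equiv> real (DIM('a) + 1)"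
  shows "f x \<le> exp (n - norm x / n)"
proof (cases "norm x \<le> n")
  case True
  have "n > 0" by (simp add: n_def)
  then have "norm x / n \<le> 1" using True by simp
  \<comment> \<open>Since d = n - 1, the global bound suffices as long as \<open>norm x / n\<close>
    is at most 1.\<close>
  then have "exp (real DIM('a)) \<le> exp (n - norm x / n)" by (simp add: n_def)
  then show ?thesis using John_function_height_le_exp_DIM[OF lc John] by (meson order_trans)
next
  case False
  define r where "r = norm x"
  have n: "n > 0" by (simp add: n_def)
  have r: "r > n" using False by (simp add: r_def)
  have small: "f y < exp (- 1)" if "norm y > n" for y
    using John_function_height_lt_exp_minus_1[OF lc John, of y] that by (simp add: n_def)
  show ?thesis
  proof (rule ccontr)
    assume "\<not> f x \<le> exp (n - norm x / n)"
    then have gt: "exp (n - r / n) < f x" by (simp add: r_def)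
    show False
    \<comment> \<open>Up to this radius the exponent \<open>n - r / n\<close> is at least -1, so
      \<open>x\<close> itself contradicts \<open>small\<close>; beyond it a point nearer to the
      origin is needed.\<close>
    proof (cases "r \<le> n\<^sup>2 + n")
      case True
      then have "r / n \<le> n + 1" using n by (simp add: field_simps power2_eq_square)
      then have "exp (- 1) \<le> exp (n - r / n)" by simp
      then show False using gt small[of x] r unfolding r_def by linarith
    next
      case False
      \<comment> \<open>\<open>l\<close> solves \<open>l * (n - r / n) = - 1\<close>, so the lower
        bound for \<open>f\<close> at \<open>l *\<^sub>R x\<close> is exactly 1/e. That point still
        lies outside the ball of radius \<open>n\<close>, because
        \<open>l * r = n * r / (r - n\<^sup>2) > n\<close>.\<close>
      define l where "l = n / (r - n\<^sup>2)"
      have l: "0 < l" "l < 1" using False n by (auto simp: l_def field_simps)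
      have f0: "1 \<le> f 0"
        using John by (auto simp: is_John_function_height_def height_fun_def dest!: spec[of _ 0])
      have "1 powr (1 - l) * exp (n - r / n) powr l \<le> f ((1 - l) *\<^sub>R 0 + l *\<^sub>R x)"
        using l gt f0 by (intro log_concave_powr_le[OF lc]) auto
      then have "exp (l * (n - r / n)) \<le> f (l *\<^sub>R x)"
        by (simp add: powr_def)
      moreover have "l * (n - r / n) = - 1"
      proof -
        have "n - r / n = - (r - n\<^sup>2) / n" using n by (simp add: field_simps power2_eq_square)
        moreover have "r - n\<^sup>2 \<noteq> 0" using False n by auto
        ultimately show ?thesis using n by (simp add: l_def field_simps)
      qed
      moreover have "n < norm (l *\<^sub>R x)"
      proof -
        have "r - n\<^sup>2 < r" "r - n\<^sup>2 > 0" using n False by auto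
        then have "n * (r - n\<^sup>2) < n * r" using n by simp
        then show ?thesis using l n \<open>r - n\<^sup>2 > 0\<close> by (simp add: l_def field_simps flip: r_def)
      qed
      ultimately show False using small[of "l *\<^sub>R x"] by simp
    qed
  qed
qed

theorem theorem5p1:
  fixes f :: "'a::euclidean_space \<Rightarrow> real"
  assumes "proper_log_concave f"
    and "is_John_function_height f"
  shows "\<forall>p. exp (- real (DIM('a) + 1)) * indicator (cball 0 (1 / real (DIM('a) + 1))) p
              \<le> polar_fun f p"
proof
  fix p :: 'a
  define n where "n = real (DIM('a) + 1)"
  have n: "n > 0" by (simp add: n_def)
  have f0: "f 0 > 0"
    using assms(2) by (auto simp: is_John_function_height_def height_fun_def dest!: spec[of _ 0])
  show "exp (- real (DIM('a) + 1)) * indicator (cball 0 (1 / real (DIM('a) + 1))) p \<le> polar_fun f p"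
    unfolding polar_fun_def n_def[symmetric]
  proof (rule cINF_greatest)
    show "{x. f x > 0} \<noteq> {}" using f0 by auto
    fix x assume "x \<in> {x. f x > 0}"
    then have fx: "f x > 0" by simp
    show "exp (- n) * indicator (cball 0 (1 / n)) p \<le> exp (- (p \<bullet> x)) / f x"
    \<comment> \<open>The radius \<open>1 / n\<close> matches the decay rate: for such
      \<open>p\<close> the inner product with \<open>x\<close> is at most \<open>norm x / n\<close>.
      For other \<open>p\<close> the left side is 0.\<close>
    proof (cases "norm p \<le> 1 / n")
      case True
      have "p \<bullet> x \<le> norm p * norm x" by (rule norm_cauchy_schwarz)
      also have "\<dots> \<le> 1 / n * norm x" using True by (rule mult_right_mono) simp
      finally have px: "p \<bullet> x \<le> norm x / n" by simp
      have "f x \<le> exp (n - norm x / n)"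
        using John_function_height_le_exp_decay[OF _ assms(2)] assms(1)
        by (simp add: proper_log_concave_def n_def)
      also have "\<dots> \<le> exp (n - p \<bullet> x)" using px by simp
      finally have "exp (- n) * f x \<le> exp (- n) * exp (n - p \<bullet> x)"
        by (rule mult_left_mono) simp
      also have "\<dots> = exp (- (p \<bullet> x))" by (simp flip: exp_add)
      finally show ?thesis using True fx by (simp add: field_simps)
    qed (use fx in simp)
  qed
qed

end
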